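(* Let $k \geq 2$ and let $H=(V,E)$ be a finite $k$-uniform hypergraph (without multiple edges) with $\Delta(H) \leq \Delta$ and $I(H)=I$, whose every vertex $v$ is equipped with a list $L_v$ of at least $R$ colors. Define $q_1:=1$ and $q_i:= \frac{i}{i-1}\sqrt[i]{i-1}$ for every $i > 1$. Then: (a) if $R \geq \left\lceil 2 + \sum_{i \in I} q_i \sqrt[i]{\frac{\Delta(\Delta-1)(k-1)}{k-i} 2^{k-i+1} f_i}\right\rceil$, there exists a list ieds-coloring of $H$; (b) if $R \geq \left\lceil 2 + \sum_{i \in I} q_i \sqrt[i]{\frac{\Delta(\Delta-1)(k-1)}{k-i}\, i!}\right\rceil$, there exists a list iedm-coloring of $H$.
   Context: For a hypergraph $H=(V,E)$ and $v\in V$, $E(v)$ is the set of edges containing $v$, $\deg v=|E(v)|$, and $\Delta(H)=\max_v \deg v$. $H$ is $k$-uniform if every edge has exactly $k$ vertices. For a $k$-uniform $H$, $I(H):=\{|P\setminus Q| : P,Q\in E\}\cap\{1,\dots,k-1\}$. $f_n$ denotes the number of total preorders of $\{1,\dots,n\}$ (orderings with possible ties; the ordered Bell / Fubini number), $f_n=\sum_{i=0}^n i!\,S(n,i)$ with $S(n,i)$ Stirling numbers of the second kind. For a coloring $\varphi: V\to\mathbb{N}$ and $X\subseteq V$, $\varphi(X)$ is the set and $\varphi\langle X\rangle$ the multiset of colors on $X$. A coloring $\varphi$ is an ieds-coloring if $\varphi(P)\neq\varphi(Q)$ for every pair of distinct intersecting edges $P,Q$; it is an iedm-coloring if $\varphi\langle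 P\rangle\neq\varphi\langle Q\rangle$ for every such pair. A list coloring is one where $\varphi(v)\in L_v$ for every vertex $v$. *)

theory Defs
  imports Complex_Main "HOL-Library.Multiset"
begin

section \<open>Uniform hypergraphs\<close>

text \<open>
  A hypergraph is given by its vertex set \<open>V\<close> and its edge set \<open>E\<close>; since \<open>E\<close> is a set of
  vertex sets, there are no multiple edges.
\<close>

definition hypergraph :: "'a set \<Rightarrow> 'a set set \<Rightarrow> bool" where
  "hypergraph V E \<longleftrightarrow> (\<forall>P\<in>E. P \<subseteq> V)"

definition uniform :: "nat \<Rightarrow> 'a set set \<Rightarrow> bool" where
  "uniform k E \<longleftrightarrow> (\<forall>P\<in>E. card P = k)"

definition edges_at :: "'a set set \<Rightarrow> 'a \<Rightarrow> 'a set set" where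
  "edges_at E v = {P\<in>E. v \<in> P}"

definition degree :: "'a set set \<Rightarrow> 'a \<Rightarrow> nat" where
  "degree E v = card (edges_at E v)"

text \<open>The inserted 0 only matters for \<open>V = {}\<close>, where the maximum degree is 0.\<close>

definition max_degree :: "'a set \<Rightarrow> 'a set set \<Rightarrow> nat" where
  "max_degree V E = Max (insert 0 (degree E ` V))"

definition diff_sizes :: "nat \<Rightarrow> 'a set set \<Rightarrow> nat set" where
  "diff_sizes k E = {card (P - Q) | P Q. P \<in> E \<and> Q \<in> E} \<inter> {1..k - 1}"


section \<open>Colorings distinguishing intersecting edges\<close>

definition ieds_coloring :: "'a set set \<Rightarrow> ('a \<Rightarrow> nat) \<Rightarrow> bool" where
  "ieds_coloring E \<phi> \<longleftrightarrow>
     (\<forall>P\<in>E. \<forall>Q\<in>E. P \<noteq> Q \<and> P \<inter> Q \<noteq> {} \<longrightarrow> \<phi> ` P \<noteq> \<phi> ` Q)"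

definition iedm_coloring :: "'a set set \<Rightarrow> ('a \<Rightarrow> nat) \<Rightarrow> bool" where
  "iedm_coloring E \<phi> \<longleftrightarrow>
     (\<forall>P\<in>E. \<forall>Q\<in>E. P \<noteq> Q \<and> P \<inter> Q \<noteq> {} \<longrightarrow>
        image_mset \<phi> (mset_set P) \<noteq> image_mset \<phi> (mset_set Q))"

definition list_coloring :: "'a set \<Rightarrow> ('a \<Rightarrow> nat set) \<Rightarrow> ('a \<Rightarrow> nat) \<Rightarrow> bool" where
  "list_coloring V L \<phi> \<longleftrightarrow> (\<forall>v\<in>V. \<phi> v \<in> L v)"

text \<open>Infinite lists are allowed; the disjunction is needed because \<^const>\<open>card\<close> is 0 on them.\<close>

definition at_least :: "nat \<Rightarrow> 'b set \<Rightarrow> bool" where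
  "at_least R A \<longleftrightarrow> infinite A \<or> R \<le> card A"


section \<open>The constants in the bounds\<close>

text \<open>Ordered Bell (Fubini) numbers: the number of total preorders of \<open>{1, \<dots>, n}\<close>.\<close>

definition total_preorders :: "nat \<Rightarrow> nat rel set" where
  "total_preorders n = {r. preorder_on {1..n} r \<and> total_on {1..n} r}"

definition fubini :: "nat \<Rightarrow> nat" where
  "fubini n = card (total_preorders n)"

definition q :: "nat \<Rightarrow> real" where
  "q i = (if i = 1 then 1 else real i / (real i - 1) * root i (real i - 1))"

end

theory Submission
  imports Defs "HOL-Library.FuncSet" "HOL-Combinatorics.Permutations"
begin

text \<open>
  Let \<open>C D\<close> be the number of conflict-free colorings of the partial vertex set \<open>D\<close>. Coloring one
  more vertex \<open>v\<close> either gives a conflict-free coloring of \<open>D \<union> {v}\<close> or creates a conflict \<open>(P, Q)\<close>;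
  in that case uncoloring \<open>U = (P - Q) \<union> {v}\<close> leaves a conflict-free coloring from which the colors
  on \<open>U\<close> can be recovered up to few choices. Hence \<open>R * C D\<close> is at most \<open>C (D \<union> {v})\<close> plus a
  weighted sum of values \<open>C (D \<union> {v} - U)\<close>, and looking at a \<open>D\<close> that maximizes
  \<open>C D / \<beta> ^ card D\<close> shows \<open>C V > 0\<close>. With \<open>w\<^sub>i\<close> the radicand in the theorem, the choice
  \<open>\<beta> = 1 + (\<Sum>i\<in>I. root i ((i - 1) * w\<^sub>i))\<close> bounds the weights by the terms \<open>q i * root i w\<^sub>i\<close>.
\<close>

section \<open>Counting maps with prescribed image\<close>

text \<open>Passing from \<open>n\<close> to \<open>n + 1\<close> multiplies the left side by
  \<open>(n + 1) * (1 + 1 / n) ^ n\<close>, and the second factor is at most e, hence below 4. This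
  crude Stirling bound later yields \<open>i \<le> 4 * \<beta>\<close> in the set version.\<close>

lemma power_le_four_power_fact: "real n ^ n \<le> 4 ^ n * fact n"
proof (induction n)
  case (Suc n)
  show ?case
  proof (cases "n = 0")
    case False
    have "(real n + 1) ^ n = real n ^ n * (1 + 1 / n) ^ n"
      using False by (simp add: field_simps flip: power_mult_distrib)
    also have "\<dots> \<le> real n ^ n * 3"
    proof (intro mult_left_mono)
      have "(1 + 1 / real n) ^ n \<le> exp 1"
        using exp_ge_one_plus_x_over_n_power_n[of n 1] False by simp
      then show "(1 + 1 / real n) ^ n \<le> 3"
        using exp_le by linarith
    qed simp
    also have "\<dots> \<le> 4 ^ n * fact n * 4"
      using Suc.IH by (intro mult_mono) auto
    finally have "(real n + 1) * (real n + 1) ^ n \<le> (real n + 1) * (4 ^ n * fact n * 4)"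
      by (intro mult_left_mono) auto
    then show ?thesis
      by (simp add: algebra_simps)
  qed simp
qed simp

text \<open>Two maps with the same multiset of values differ by a permutation of \<open>A\<close>,
  so one fixed solution composed with all permutations reaches every other.\<close>

lemma card_image_mset_eq_le:
  assumes "finite A"
  shows "card {f \<in> extensional A. image_mset f (mset_set A) = M} \<le> fact (card A)" (is "card ?F \<le> _")
proof (cases "?F = {}")
  case False
  then obtain g where g: "image_mset g (mset_set A) = M"
    by auto
  have "?F \<subseteq> (\<lambda>p. restrict (g \<circ> p) A) ` {p. p permutes A}"
  proof
    fix f assume f: "f \<in> ?F"
    then have "image_mset f (mset_set A) = image_mset g (mset_set A)"
      using g by simp
    then obtain p where "p permutes A" "\<forall>x\<in>A. f x = g (p x)"
      by (rule image_mset_eq_implies_permutes[OF assms])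
    moreover from this f have "f = restrict (g \<circ> p) A"
      by (auto simp: extensional_def restrict_def)
    ultimately show "f \<in> (\<lambda>p. restrict (g \<circ> p) A) ` {p. p permutes A}"
      by blast
  qed
  then have "card ?F \<le> card {p. p permutes A}"
    using assms by (intro surj_card_le) (auto simp: finite_permutations)
  then show ?thesis
    using card_permutations[OF refl assms] by simp
next
  case True
  then show ?thesis
    by (simp only: card.empty)
qed

lemma finite_image_mset_eq:
  assumes "finite A"
  shows "finite {f \<in> extensional A. image_mset f (mset_set A) = M}"
proof (rule finite_subset)
  show "{f \<in> extensional A. image_mset f (mset_set A) = M} \<subseteq> PiE A (\<lambda>_. set_mset M)"
    using assms by (auto simp: PiE_def)
  show "finite (PiE A (\<lambda>_. set_mset M))"
    using assms by (intro finite_PiE) auto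
qed

text \<open>A map onto a fixed chain is determined by the total preorder it induces on its domain.\<close>

lemma surj_eq_if_same_preorder:
  fixes f g :: "'a \<Rightarrow> 'b::wellorder"
  assumes "f ` A = g ` A"
    and le: "\<And>a b. a \<in> A \<Longrightarrow> b \<in> A \<Longrightarrow> f a \<le> f b \<longleftrightarrow> g a \<le> g b"
    and "a \<in> A"
  shows "f a = g a"
  using \<open>a \<in> A\<close>
proof (induction "min (f a) (g a)" arbitrary: a rule: less_induct)
  case less
  \<comment> \<open>Applied to both orders of \<open>f\<close> and \<open>g\<close>. Equality of the
    images provides \<open>b\<close> with \<open>h' b = h a\<close>, and the agreement of the orders
    gives \<open>h b < h a\<close>. The induction hypothesis at \<open>b\<close> would then force
    \<open>h b = h' b = h a\<close>.\<close>
  have *: False if "h a < h' a" "h' b = h a" "h b < h a" "b \<in> A"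
    "h = f \<and> h' = g \<or> h = g \<and> h' = f" for b h h'
  proof -
    have "min (f b) (g b) = h b" "min (f a) (g a) = h a"
      using that by (auto simp: min_def)
    then show False
      using that less.hyps[of b] by auto
  qed
  show ?case
  proof (rule ccontr)
    assume "f a \<noteq> g a"
    then consider "f a < g a" | "g a < f a"
      by fastforce
    then show False
    proof cases
      case 1
      obtain b where "b \<in> A" "g b = f a"
        using assms(1) less.prems by (metis imageE imageI)
      then show False
        using *[of f g b] 1 le[of a b] less.prems by (auto simp: not_le)
    next
      case 2
      obtain b where "b \<in> A" "f b = g a"
        using assms(1) less.prems by (metis imageE imageI)
      then show False
        using *[of g f b] 2 le[of a b] less.prems by (auto simp: not_le)
    qed
  qed
qed

lemma finite_surj_extensional:
  assumes "finite A"
  shows "finite {f \<in> extensional A. f ` A = X}"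
proof (cases "finite X")
  case True
  then show ?thesis
    using assms finite_PiE[of A "\<lambda>_. X"]
    by (auto simp: PiE_def elim!: finite_subset[rotated])
next
  case False
  then have "{f \<in> extensional A. f ` A = X} = {}"
    using assms by auto
  then show ?thesis
    by (simp only: finite.emptyI)
qed

lemma finite_total_preorders: "finite (total_preorders n)"
  by (rule finite_subset[of _ "Pow ({1..n} \<times> {1..n})"])
    (auto simp: total_preorders_def preorder_on_def)

text \<open>Pulling the order of the colors back along an enumeration \<open>h\<close> of
  \<open>A\<close> encodes \<open>f\<close> as a total preorder of \<open>{1..card A}\<close>,
  injectively by the previous uniqueness result. Only preorders with \<open>card X\<close> classes
  arise; counting all of them makes the bound independent of \<open>X\<close>.\<close>

lemma card_surj_le_fubini:
  fixes X :: "nat set"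
  assumes "finite A"
  shows "card {f \<in> extensional A. f ` A = X} \<le> fubini (card A)" (is "card ?F \<le> _")
proof -
  obtain h where h: "bij_betw h {1..card A} A"
    using ex_bij_betw_nat_finite_1[OF assms] by blast
  define ord where
    "ord f = {(x, y). x \<in> {1..card A} \<and> y \<in> {1..card A} \<and> f (h x) \<le> f (h y)}" for f :: "'a \<Rightarrow> nat"
  have "inj_on ord ?F"
  proof (rule inj_onI)
    fix f g assume f: "f \<in> ?F" and g: "g \<in> ?F" and eq: "ord f = ord g"
    have "f a \<le> f b \<longleftrightarrow> g a \<le> g b" if "a \<in> A" "b \<in> A" for a b
    proof -
      have "a \<in> h ` {1..card A}" "b \<in> h ` {1..card A}"
        using that by (simp_all only: bij_betw_imp_surj_on[OF h])
      then obtain x y where "x \<in> {1..card A}" "y \<in> {1..card A}" "a = h x" "b = h y"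
        by blast
      then show ?thesis
        using eq by (auto simp: ord_def set_eq_iff)
    qed
    then have "f a = g a" if "a \<in> A" for a
      using surj_eq_if_same_preorder[of f A g a] f g that by auto
    then show "f = g"
      using f g by (auto intro: extensionalityI)
  qed
  moreover have "ord f \<in> total_preorders (card A)" for f
    unfolding total_preorders_def preorder_on_def refl_on_def total_on_def trans_def ord_def
    by auto
  then have "ord ` ?F \<subseteq> total_preorders (card A)"
    by blast
  ultimately show ?thesis
    unfolding fubini_def by (rule card_inj_on_le[OF _ _ finite_total_preorders])
qed

text \<open>Permutations of \<open>{1..n}\<close> are particular surjections onto
  \<open>{1..n}\<close>. The bound serves to show that the radicand \<open>w i\<close> is at least
  \<open>i!\<close>.\<close>

lemma fact_le_fubini: "fact n \<le> fubini n"
proof -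
  have "card {p. p permutes {1..n}} \<le> card {f \<in> extensional {1..n}. f ` {1..n} = {1..n}}"
  proof (rule card_inj_on_le)
    show "inj_on (\<lambda>p. restrict p {1..n}) {p. p permutes {1..n}}"
    proof (rule inj_onI)
      fix p r assume "p \<in> {p. p permutes {1..n}}" "r \<in> {p. p permutes {1..n}}"
        and "restrict p {1..n} = restrict r {1..n}"
      then have "p x = r x" for x
        by (cases "x \<in> {1..n}") (auto simp: permutes_not_in dest: fun_cong[of _ _ x])
      then show "p = r" ..
    qed
    show "(\<lambda>p. restrict p {1..n}) ` {p. p permutes {1..n}} \<subseteq> {f \<in> extensional {1..n}. f ` {1..n} = {1..n}}"
      by (auto simp del: One_nat_def atLeastAtMost_iff simp: permutes_image permutes_in_image)
    show "finite {f \<in> extensional {1..n}. f ` {1..n} = {1..n}}"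
      by (simp add: finite_surj_extensional)
  qed
  also have "\<dots> \<le> fubini n"
    using card_surj_le_fubini[of "{1..n}" "{1..n}"] by simp
  finally show ?thesis
    using card_permutations[of "{1..n}" n] by simp
qed

text \<open>The image of \<open>f\<close> must cover \<open>Z - Y\<close>, and the only freedom left
  is which part \<open>T\<close> of \<open>Y\<close> it meets.\<close>

lemma image_Un_eq_subset:
  "{f \<in> extensional A. f ` A \<union> Y = Z} \<subseteq> (\<Union>T\<in>Pow Y. {f \<in> extensional A. f ` A = (Z - Y) \<union> T})"
  (is "_ \<subseteq> ?U")
proof
  fix f assume "f \<in> {f \<in> extensional A. f ` A \<union> Y = Z}"
  then have "f \<in> extensional A" "f ` A = (Z - Y) \<union> (f ` A \<inter> Y)"
    by auto
  then show "f \<in> ?U"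
    by (intro UN_I[of "f ` A \<inter> Y"]) simp_all
qed

lemma finite_image_Un_eq:
  assumes "finite A" "finite Y"
  shows "finite {f \<in> extensional A. f ` A \<union> Y = Z}"
  by (rule finite_subset[OF image_Un_eq_subset]) (use assms finite_surj_extensional in auto)

text \<open>In a conflict, \<open>A\<close> is the uncolored set \<open>P - Q\<close>,
  \<open>Y\<close> the known colors on the rest of \<open>P\<close>, and \<open>Z\<close> the color
  set that \<open>P\<close> has to get. Each of the \<open>2 ^ card Y\<close> candidate images is
  then counted by ordered Bell numbers.\<close>

lemma card_image_Un_eq_le:
  fixes Y Z :: "nat set"
  assumes "finite A" "finite Y"
  shows "card {f \<in> extensional A. f ` A \<union> Y = Z} \<le> 2 ^ card Y * fubini (card A)" (is "card ?F \<le> _")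
proof -
  have "card ?F \<le> card (\<Union>T\<in>Pow Y. {f \<in> extensional A. f ` A = (Z - Y) \<union> T})"
    by (rule card_mono[OF _ image_Un_eq_subset]) (use assms finite_surj_extensional in auto)
  also have "\<dots> \<le> (\<Sum>T\<in>Pow Y. card {f \<in> extensional A. f ` A = (Z - Y) \<union> T})"
    using assms by (intro card_UN_le) auto
  also have "\<dots> \<le> (\<Sum>T\<in>Pow Y. fubini (card A))"
    using assms by (intro sum_mono card_surj_le_fubini)
  also have "\<dots> = 2 ^ card Y * fubini (card A)"
    using assms by (simp add: card_Pow)
  finally show ?thesis .
qed


section \<open>The counting argument\<close>

text \<open>If \<open>C V = 0\<close>, a set \<open>D\<close> maximizing
  \<open>C D / \<beta> ^ card D\<close> is not \<open>V\<close>, so some \<open>v\<close> can be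
  added to it. Bounding every count on the right of \<open>ext\<close> by the maximum and applying
  \<open>weight\<close> gives \<open>R * C D < R * C D\<close>.\<close>

lemma positive_of_extension_inequalities:
  fixes C :: "'a set \<Rightarrow> real" and m :: "'a \<Rightarrow> 'b \<Rightarrow> real" and U :: "'a \<Rightarrow> 'b \<Rightarrow> 'a set"
  assumes V: "finite V" and J: "\<And>v. v \<in> V \<Longrightarrow> finite (J v)"
    and m: "\<And>v j. v \<in> V \<Longrightarrow> j \<in> J v \<Longrightarrow> m v j \<ge> 0"
    and \<beta>: "\<beta> > 0" and nonneg: "\<And>D. C D \<ge> 0" and pos: "C {} > 0"
    and weight: "\<And>v. v \<in> V \<Longrightarrow> \<beta> + (\<Sum>j\<in>J v. m v j * (\<beta> / \<beta> ^ card (U v j))) < R"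
    and ext: "\<And>D v. D \<subseteq> V \<Longrightarrow> v \<in> V - D \<Longrightarrow>
      R * C D \<le> C (insert v D) +
        (\<Sum>j | j \<in> J v \<and> U v j \<subseteq> insert v D. m v j * C (insert v D - U v j))"
  shows "C V > 0"
proof (rule ccontr)
  assume "\<not> C V > 0"
  then have CV: "C V = 0"
    using nonneg[of V] by linarith
  define K where "K = Max ((\<lambda>D. C D / \<beta> ^ card D) ` Pow V)"
  have "K \<in> (\<lambda>D. C D / \<beta> ^ card D) ` Pow V"
    unfolding K_def using V by (intro Max_in) auto
  then obtain D where D: "D \<subseteq> V" "K = C D / \<beta> ^ card D"
    by auto
  have le_K: "C D' \<le> K * \<beta> ^ card D'" if "D' \<subseteq> V" for D'
  proof -
    have "C D' / \<beta> ^ card D' \<le> K"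
      unfolding K_def using V that by (intro Max_ge) auto
    then show ?thesis
      using \<beta> by (simp add: field_simps)
  qed
  have "K > 0"
    using le_K[of "{}"] pos by simp
  then have "D \<noteq> V"
    using D CV by auto
  then obtain v where v: "v \<in> V" "v \<notin> D"
    using D by blast
  have "finite D"
    using D V finite_subset by blast
  \<comment> \<open>The set \<open>insert v D - U v j\<close> has
    \<open>card D + 1 - card (U v j)\<close> elements, which is where the factor
    \<open>\<beta> / \<beta> ^ card (U v j)\<close> in the weights comes from.\<close>
  have term_le: "m v j * C (insert v D - U v j) \<le> K * \<beta> ^ card D * (m v j * (\<beta> / \<beta> ^ card (U v j)))"
    if "j \<in> J v" "U v j \<subseteq> insert v D" for j
  proof -
    have "C (insert v D - U v j) \<le> K * \<beta> ^ card (insert v D - U v j)"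
      using v D by (intro le_K) auto
    also have "card (insert v D - U v j) = Suc (card D) - card (U v j)"
      using card_Diff_subset[OF finite_subset[OF that(2)] that(2)] v \<open>finite D\<close> by simp
    also have "\<beta> ^ (Suc (card D) - card (U v j)) = \<beta> ^ card D * (\<beta> / \<beta> ^ card (U v j))"
    proof -
      have "card (U v j) \<le> Suc (card D)"
        using card_mono[OF _ that(2)] v \<open>finite D\<close> by simp
      then show ?thesis
        using \<beta> by (simp add: power_diff)
    qed
    finally have "m v j * C (insert v D - U v j) \<le> m v j * (K * (\<beta> ^ card D * (\<beta> / \<beta> ^ card (U v j))))"
      using m that v by (intro mult_left_mono) auto
    then show ?thesis
      by (simp add: mult_ac)
  qed
  have "R * C D \<le> C (insert v D) +
      (\<Sum>j | j \<in> J v \<and> U v j \<subseteq> insert v D. m v j * C (insert v D - U v j))"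
    using ext D v by blast
  also have "\<dots> \<le> K * \<beta> ^ card D * \<beta> +
      (\<Sum>j | j \<in> J v \<and> U v j \<subseteq> insert v D. K * \<beta> ^ card D * (m v j * (\<beta> / \<beta> ^ card (U v j))))"
    using term_le le_K[of "insert v D"] D v \<open>finite D\<close>
    by (intro add_mono sum_mono) (auto simp: mult_ac)
  also have "\<dots> \<le> K * \<beta> ^ card D * \<beta> +
      (\<Sum>j\<in>J v. K * \<beta> ^ card D * (m v j * (\<beta> / \<beta> ^ card (U v j))))"
    using J m v \<beta> \<open>K > 0\<close> by (intro add_left_mono sum_mono2) auto
  also have "\<dots> = K * \<beta> ^ card D * (\<beta> + (\<Sum>j\<in>J v. m v j * (\<beta> / \<beta> ^ card (U v j))))"
    by (simp add: ring_distribs sum_distrib_left)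
  also have "\<dots> < K * \<beta> ^ card D * R"
    using weight v \<beta> \<open>K > 0\<close> by (intro mult_strict_left_mono) auto
  also have "\<dots> = R * C D"
    using D \<beta> by simp
  finally show False
    by simp
qed

lemma card_le_of_fibres:
  assumes "finite B" "finite T" "f ` B \<subseteq> T" "\<And>y. y \<in> T \<Longrightarrow> card {x \<in> B. f x = y} \<le> n"
  shows "card B \<le> n * card T"
proof -
  have "B = (\<Union>y\<in>T. {x \<in> B. f x = y})"
    using assms by auto
  then have "card B \<le> (\<Sum>y\<in>T. card {x \<in> B. f x = y})"
    using card_UN_le[OF assms(2), of "\<lambda>y. {x \<in> B. f x = y}"] by simp
  also have "\<dots> \<le> (\<Sum>y\<in>T. n)"
    using assms by (intro sum_mono)
  finally show ?thesis
    by (simp add: mult.commute)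
qed

text \<open>Here \<open>C D\<close> counts the good list colorings of \<open>D\<close>. The index
  \<open>j\<close> names a way for the extension to \<open>v\<close> to fail, and
  \<open>fibre\<close> bounds by \<open>m v j\<close> the number of failed colorings that look alike
  after uncoloring \<open>U v j\<close>. Leaving \<open>good\<close> and \<open>bad\<close> abstract
  lets both versions of the theorem use the same argument.\<close>

lemma coloring_exists:
  fixes L :: "'a \<Rightarrow> 'c set" and good :: "'a set \<Rightarrow> ('a \<Rightarrow> 'c) \<Rightarrow> bool"
    and m :: "'a \<Rightarrow> 'b \<Rightarrow> nat" and U :: "'a \<Rightarrow> 'b \<Rightarrow> 'a set"
    and bad :: "'a set \<Rightarrow> 'a \<Rightarrow> 'b \<Rightarrow> ('a \<Rightarrow> 'c) \<Rightarrow> bool"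
  assumes V: "finite V" and L: "\<And>v. v \<in> V \<Longrightarrow> finite (L v) \<and> card (L v) = R"
    and \<beta>: "\<beta> > 0" and J: "\<And>v. v \<in> V \<Longrightarrow> finite (J v)"
    and good_empty: "good {} (\<lambda>_. undefined)"
    and good_restrict: "\<And>D D' \<phi>. D \<subseteq> V \<Longrightarrow> D' \<subseteq> D \<Longrightarrow> good D \<phi> \<Longrightarrow> good D' (restrict \<phi> D')"
    and conflict: "\<And>D v \<phi>. D \<subseteq> V \<Longrightarrow> v \<in> V - D \<Longrightarrow> good D (restrict \<phi> D) \<Longrightarrow> \<not> good (insert v D) \<phi> \<Longrightarrow>
      \<exists>j\<in>J v. U v j \<subseteq> insert v D \<and> bad D v j \<phi>"
    and U: "\<And>v j. v \<in> V \<Longrightarrow> j \<in> J v \<Longrightarrow> v \<in> U v j"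
    and fibre: "\<And>D v j \<psi>. D \<subseteq> V \<Longrightarrow> v \<in> V - D \<Longrightarrow> j \<in> J v \<Longrightarrow> U v j \<subseteq> insert v D \<Longrightarrow>
      card {\<phi> \<in> PiE (insert v D) L. bad D v j \<phi> \<and> restrict \<phi> (insert v D - U v j) = \<psi>} \<le> m v j"
    and weight: "\<And>v. v \<in> V \<Longrightarrow>
      \<beta> + (\<Sum>j\<in>J v. real (m v j) * (\<beta> / \<beta> ^ card (U v j))) < real R"
  shows "\<exists>\<phi>\<in>PiE V L. good V \<phi>"
proof -
  define G where "G D = {\<phi> \<in> PiE D L. good D \<phi>}" for D
  have fin_PiE: "finite (PiE D L)" if "D \<subseteq> V" for D
    using that V L by (intro finite_PiE) (auto intro: finite_subset)
  have fin_G: "finite (G D)" if "D \<subseteq> V" for D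
    using fin_PiE[OF that] by (simp add: G_def)
  have "real (card (G V)) > 0"
  proof (rule positive_of_extension_inequalities[where C = "\<lambda>D. real (card (G D))" and J = J
        and m = "\<lambda>v j. real (m v j)" and U = U and R = "real R", OF V J _ \<beta> _ _ weight])
    have "G {} = {\<lambda>_. undefined}"
      using good_empty by (auto simp: G_def)
    then show "0 < real (card (G {}))"
      by simp
  next
    fix D v assume D: "D \<subseteq> V" and v: "v \<in> V - D"
    then have D': "insert v D \<subseteq> V"
      by blast
    let ?J = "{j \<in> J v. U v j \<subseteq> insert v D}"
    \<comment> \<open>Each good coloring of \<open>D\<close> extends by any of the \<open>R\<close>
      colors of \<open>v\<close>, giving \<open>R * card (G D)\<close> members of \<open>X\<close>.
      Each member of \<open>X\<close> is good on \<open>insert v D\<close> or lies in some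
      \<open>B j\<close>.\<close>
    define X where "X = {\<phi> \<in> PiE (insert v D) L. restrict \<phi> D \<in> G D}"
    define B where "B j = {\<phi> \<in> X. bad D v j \<phi>}" for j
    have fin_X: "finite X"
      using fin_PiE[OF D'] by (simp add: X_def)
    have "R * card (G D) = card (L v \<times> G D)"
      using L v by (simp add: card_cartesian_product)
    also have "\<dots> \<le> card X"
    proof (rule card_inj_on_le[where f = "\<lambda>(c, \<phi>). \<phi>(v := c)"])
      show "inj_on (\<lambda>(c, \<phi>). \<phi>(v := c)) (L v \<times> G D)"
      proof (rule inj_onI, clarify)
        fix c \<phi> c' \<phi>'
        assume *: "\<phi> \<in> G D" "\<phi>' \<in> G D" "\<phi>(v := c) = \<phi>'(v := c')"
        have "\<phi> x = \<phi>' x" for x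
        proof (cases "x = v")
          case True
          then show ?thesis
            using *(1,2) v by (auto simp: G_def PiE_def extensional_def)
        next
          case False
          then show ?thesis
            using fun_cong[OF *(3), of x] by simp
        qed
        then show "c = c' \<and> \<phi> = \<phi>'"
          using fun_cong[OF *(3), of v] by auto
      qed
      show "(\<lambda>(c, \<phi>). \<phi>(v := c)) ` (L v \<times> G D) \<subseteq> X"
      proof clarify
        fix c \<phi> assume c: "c \<in> L v" and \<phi>: "\<phi> \<in> G D"
        have "restrict (\<phi>(v := c)) D = \<phi>"
          using v \<phi> by (auto simp: G_def PiE_def extensional_def restrict_def)
        moreover have "\<phi>(v := c) \<in> PiE (insert v D) L"
          using c \<phi> by (intro PiE_fun_upd) (auto simp: G_def)
        ultimately show "\<phi>(v := c) \<in> X"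
          using \<phi> by (simp add: X_def)
      qed
    qed (rule fin_X)
    also have "\<dots> \<le> card (G (insert v D) \<union> (\<Union>j\<in>?J. B j))"
    proof (rule card_mono)
      show "finite (G (insert v D) \<union> (\<Union>j\<in>?J. B j))"
        using fin_G[OF D'] fin_X J v by (auto simp: B_def)
      show "X \<subseteq> G (insert v D) \<union> (\<Union>j\<in>?J. B j)"
        using conflict[OF D v] by (fastforce simp: X_def G_def B_def)
    qed
    also have "\<dots> \<le> card (G (insert v D)) + (\<Sum>j\<in>?J. card (B j))"
      using J v by (intro order.trans[OF card_Un_le] add_left_mono card_UN_le) auto
    also have "\<dots> \<le> card (G (insert v D)) + (\<Sum>j\<in>?J. m v j * card (G (insert v D - U v j)))"
    proof (intro add_left_mono sum_mono)
      fix j assume "j \<in> ?J"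
      then have j: "j \<in> J v" "U v j \<subseteq> insert v D"
        by auto
      show "card (B j) \<le> m v j * card (G (insert v D - U v j))"
      proof (rule card_le_of_fibres[where f = "\<lambda>\<phi>. restrict \<phi> (insert v D - U v j)"])
        show "finite (B j)"
          using fin_X by (simp add: B_def)
        show "finite (G (insert v D - U v j))"
          using D' by (intro fin_G) auto
        show "(\<lambda>\<phi>. restrict \<phi> (insert v D - U v j)) ` B j \<subseteq> G (insert v D - U v j)"
        proof (rule image_subsetI)
          fix \<phi> assume "\<phi> \<in> B j"
          then have \<phi>: "\<phi> \<in> PiE (insert v D) L" "good D (restrict \<phi> D)"
            by (auto simp: B_def X_def G_def)
          \<comment> \<open>Since \<open>v\<close> itself gets uncolored, what remains lies in
            \<open>D\<close>, where the coloring was good before \<open>v\<close> was added.\<close>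
          have sub: "insert v D - U v j \<subseteq> D"
            using U[of v j] v j by auto
          then have "restrict (restrict \<phi> D) (insert v D - U v j) = restrict \<phi> (insert v D - U v j)"
            by (simp add: Int_absorb1)
          then show "restrict \<phi> (insert v D - U v j) \<in> G (insert v D - U v j)"
            using good_restrict[OF D sub \<phi>(2)] \<phi>(1) by (auto simp: G_def)
        qed
        show "card {\<phi> \<in> B j. restrict \<phi> (insert v D - U v j) = \<psi>} \<le> m v j" for \<psi>
        proof (rule order.trans[OF card_mono fibre[OF D v j]])
          show "finite {\<phi> \<in> PiE (insert v D) L. bad D v j \<phi> \<and> restrict \<phi> (insert v D - U v j) = \<psi>}"
            using fin_PiE[OF D'] by simp
        qed (auto simp: B_def X_def)
      qed
    qed
    finally have "real (R * card (G D)) \<le>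
        real (card (G (insert v D)) + (\<Sum>j\<in>?J. m v j * card (G (insert v D - U v j))))"
      by (rule of_nat_mono)
    then show "real R * real (card (G D)) \<le> real (card (G (insert v D))) +
        (\<Sum>j\<in>?J. real (m v j) * real (card (G (insert v D - U v j))))"
      by simp
  qed auto
  then have "G V \<noteq> {}"
    by auto
  then show ?thesis
    by (auto simp: G_def)
qed

section \<open>Choice of the parameter \<beta>\<close>

text \<open>For \<open>i \<ge> 2\<close> and \<open>w i > 0\<close>, the function
  \<open>x + w i / x ^ (i - 1)\<close> of \<open>x > 0\<close> is minimal at
  \<open>x = root i ((i - 1) * w i)\<close>, with minimum \<open>q i * root i (w i)\<close>. Now
  \<beta> is 1 plus the sum of these minimizers, hence at least each of them, so every second
  summand only shrinks when \<open>x\<close> is replaced by \<beta>.\<close>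

lemma weight_sum_le:
  fixes w :: "nat \<Rightarrow> real" and I :: "nat set"
  assumes I: "finite I" "0 \<notin> I" and w: "\<And>i. i \<in> I \<Longrightarrow> w i \<ge> 0"
  defines "\<beta> \<equiv> 1 + (\<Sum>i\<in>I. root i ((real i - 1) * w i))"
  shows "\<beta> + (\<Sum>i\<in>I. w i * (\<beta> / \<beta> ^ i)) \<le> 1 + (\<Sum>i\<in>I. q i * root i (w i))"
proof -
  define b where "b i = root i ((real i - 1) * w i)" for i
  have nonneg: "b i \<ge> 0" if "i \<in> I" for i
    using that I w[OF that] unfolding b_def by (cases "i = 0") (auto intro!: real_root_ge_zero mult_nonneg_nonneg)
  have "\<beta> \<ge> 1"
    unfolding \<beta>_def using nonneg by (auto simp: b_def intro: sum_nonneg)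
  have b_le: "b i \<le> \<beta>" if "i \<in> I" for i
    using member_le_sum[of i I b] nonneg that I by (simp add: \<beta>_def b_def)
  have "b i + w i * (\<beta> / \<beta> ^ i) \<le> q i * root i (w i)" if i: "i \<in> I" for i
  proof -
    consider "i = 1" | "i \<ge> 2"
      using i I by (metis One_nat_def Suc_1 Suc_leI not_gr0 not_less_eq_eq le_antisym)
    then show ?thesis
    proof cases
      \<comment> \<open>Here \<open>b i = 0\<close> and \<open>\<beta> / \<beta> ^ i = 1\<close>, so
        both sides equal \<open>w i\<close>.\<close>
      case 1
      then show ?thesis
        using \<open>\<beta> \<ge> 1\<close> by (simp add: b_def q_def)
    next
      case 2
      show ?thesis
      proof (cases "w i = 0")
        case False
        then have wi: "w i > 0"
          using w i by force
        then have b_pos: "b i > 0"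
          using 2 by (simp add: b_def)
        have "b i ^ i = (real i - 1) * w i"
          using 2 wi by (simp add: b_def)
        then have "w i = b i ^ i / (real i - 1)"
          using 2 by (simp add: field_simps)
        also have "b i ^ i = b i ^ (i - 1) * b i"
          using 2 by (metis One_nat_def Suc_pred le_0_eq not_gr0 numeral_2_eq_2 old.nat.distinct(1) power_Suc2)
        finally have w_eq: "w i = b i ^ (i - 1) * b i / (real i - 1)" .
        have "\<beta> / \<beta> ^ i = 1 / \<beta> ^ (i - 1)"
          using 2 \<open>\<beta> \<ge> 1\<close> by (cases i) auto
        also have "\<dots> \<le> 1 / b i ^ (i - 1)"
          using b_pos b_le[OF i] by (intro divide_left_mono power_mono) auto
        finally have "w i * (\<beta> / \<beta> ^ i) \<le> w i * (1 / b i ^ (i - 1))"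
          using wi by (intro mult_left_mono) auto
        also have "\<dots> = b i / (real i - 1)"
          using b_pos by (subst w_eq) simp
        finally have "b i + w i * (\<beta> / \<beta> ^ i) \<le> real i / (real i - 1) * b i"
          using 2 by (simp add: field_simps)
        also have "\<dots> = q i * root i (w i)"
          using 2 by (simp add: b_def q_def real_root_mult)
        finally show ?thesis .
      qed (simp add: b_def)
    qed
  qed
  then have "(\<Sum>i\<in>I. b i + w i * (\<beta> / \<beta> ^ i)) \<le> (\<Sum>i\<in>I. q i * root i (w i))"
    by (rule sum_mono)
  then show ?thesis
    by (simp add: \<beta>_def b_def sum.distrib)
qed


section \<open>Pairs of intersecting edges\<close>

text \<open>Outside \<open>U\<close> the coloring is given by \<psi>, so the data
  \<open>g \<phi>\<close> that fix it on \<open>U\<close> determine it entirely. The map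
  \<open>g\<close> is general because the set version also records the color of
  \<open>v\<close>.\<close>

lemma card_le_of_determined_fibre:
  assumes "finite T"
    and S: "\<And>\<phi>. \<phi> \<in> S \<Longrightarrow> \<phi> \<in> extensional D \<and> restrict \<phi> (D - U) = \<psi> \<and> g \<phi> \<in> T"
    and g: "\<And>\<phi> \<phi>' x. g \<phi> = g \<phi>' \<Longrightarrow> x \<in> U \<Longrightarrow> \<phi> x = \<phi>' x"
  shows "card S \<le> card T"
proof (rule card_inj_on_le[of g])
  show "inj_on g S"
  proof (rule inj_onI)
    fix \<phi> \<phi>' assume *: "\<phi> \<in> S" "\<phi>' \<in> S" "g \<phi> = g \<phi>'"
    show "\<phi> = \<phi>'"
    proof (rule extensionalityI)
      show "\<phi> \<in> extensional D" "\<phi>' \<in> extensional D"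
        using S * by auto
      fix x assume "x \<in> D"
      show "\<phi> x = \<phi>' x"
      proof (cases "x \<in> U")
        case False
        have "restrict \<phi> (D - U) x = restrict \<phi>' (D - U) x"
          using S[OF *(1)] S[OF *(2)] by simp
        then show ?thesis
          using False \<open>x \<in> D\<close> by simp
      qed (rule g[OF *(3)])
    qed
  qed
qed (use assms in auto)

lemma image_mset_restrict_subset:
  assumes "A \<subseteq> D"
  shows "image_mset (restrict \<phi> D) (mset_set A) = image_mset \<phi> (mset_set A)"
  using assms by (cases "finite A") (auto intro!: image_mset_cong)

section \<open>Degrees and double counting in a uniform hypergraph\<close>

locale bounded_degree_hypergraph =
  fixes V :: "'a set" and E :: "'a set set" and k \<Delta> :: nat
  assumes k_ge_2: "2 \<le> k" and finite_V: "finite V" and hypergraph: "hypergraph V E"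
    and uniform: "uniform k E" and max_degree_le: "max_degree V E \<le> \<Delta>"
begin

lemma edge_subset: "P \<in> E \<Longrightarrow> P \<subseteq> V"
  using hypergraph by (auto simp: hypergraph_def)

lemma finite_edge: "P \<in> E \<Longrightarrow> finite P"
  using edge_subset finite_V finite_subset by blast

lemma card_edge: "P \<in> E \<Longrightarrow> card P = k"
  using uniform by (auto simp: uniform_def)

lemma finite_E: "finite E"
  using edge_subset finite_V by (intro finite_subset[of E "Pow V"]) auto

lemma card_edges_at_le:
  assumes "v \<in> V"
  shows "card {P \<in> E. v \<in> P} \<le> \<Delta>"
proof -
  have "degree E v \<le> max_degree V E"
    unfolding max_degree_def using assms finite_V by (intro Max_ge) auto
  then show ?thesis
    using max_degree_le by (simp add: degree_def edges_at_def)
qed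

lemma card_other_edges_at_le:
  assumes "P \<in> E" "u \<in> P" "\<Q> \<subseteq> E - {P}"
  shows "card {Q \<in> \<Q>. u \<in> Q} \<le> \<Delta> - 1"
proof -
  have "card {Q \<in> \<Q>. u \<in> Q} \<le> card ({Q \<in> E. u \<in> Q} - {P})"
    using assms finite_E by (intro card_mono) auto
  also have "\<dots> = card {Q \<in> E. u \<in> Q} - 1"
    using assms finite_E by (simp add: card_Diff_singleton)
  also have "\<dots> \<le> \<Delta> - 1"
    using card_edges_at_le[of u] edge_subset assms by (intro diff_le_mono) auto
  finally show ?thesis .
qed

text \<open>Double counting of the pairs \<open>(u, Q)\<close> with
  \<open>u \<in> P \<inter> Q\<close> and \<open>u \<noteq> v\<close>: there are
  \<open>k - 1\<close> choices of \<open>u\<close>, each in at most \<open>\<Delta> - 1\<close>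
  edges other than \<open>P\<close>.\<close>

lemma sum_card_inter_le:
  assumes P: "P \<in> E" "v \<in> P" and \<Q>: "\<Q> \<subseteq> E - {P}"
  shows "(\<Sum>Q\<in>\<Q>. card (P \<inter> Q - {v})) \<le> (k - 1) * (\<Delta> - 1)"
proof -
  have fin: "finite \<Q>" "finite (P - {v})"
    using \<Q> finite_E finite_edge[OF P(1)] finite_subset by (blast, blast)
  have "(\<Sum>Q\<in>\<Q>. card (P \<inter> Q - {v})) = (\<Sum>Q\<in>\<Q>. \<Sum>u\<in>P - {v}. of_bool (u \<in> Q))"
  proof (rule sum.cong)
    fix Q
    have "P \<inter> Q - {v} = (P - {v}) \<inter> Q"
      by blast
    then show "card (P \<inter> Q - {v}) = (\<Sum>u\<in>P - {v}. of_bool (u \<in> Q))"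
      using fin by simp
  qed simp
  also have "\<dots> = (\<Sum>u\<in>P - {v}. \<Sum>Q\<in>\<Q>. of_bool (u \<in> Q))"
    by (rule sum.swap)
  also have "\<dots> = (\<Sum>u\<in>P - {v}. card {Q \<in> \<Q>. u \<in> Q})"
    using fin by (simp add: Collect_conj_eq)
  also have "\<dots> \<le> (\<Sum>u\<in>P - {v}. \<Delta> - 1)"
    using card_other_edges_at_le P \<Q> by (intro sum_mono) auto
  also have "\<dots> = (k - 1) * (\<Delta> - 1)"
    using P card_edge finite_edge by simp
  finally show ?thesis .
qed

lemma card_Diff_Int_edge:
  assumes "P \<in> E"
  shows "card (P - Q) + card (P \<inter> Q) = k"
  using card_Int_Diff[of P Q] finite_edge card_edge assms by simp

lemma card_Diff_in_diff_sizes: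
  assumes "P \<in> E" "Q \<in> E" "P \<noteq> Q" "P \<inter> Q \<noteq> {}"
  shows "card (P - Q) \<in> diff_sizes k E"
proof -
  have "P - Q \<noteq> {}"
    using assms card_subset_eq[of Q P] card_edge finite_edge by auto
  then have "card (P - Q) \<noteq> 0" "card (P \<inter> Q) \<noteq> 0"
    using assms finite_edge by auto
  then have "card (P - Q) \<in> {1..k - 1}"
    using card_Diff_Int_edge[OF assms(1), of Q] by simp
  then show ?thesis
    using assms by (auto simp: diff_sizes_def)
qed

lemma diff_sizes_bounds: "i \<in> diff_sizes k E \<Longrightarrow> 1 \<le> i \<and> i < k"
  using k_ge_2 by (auto simp: diff_sizes_def)

lemma finite_diff_sizes: "finite (diff_sizes k E)"
  by (simp add: diff_sizes_def)

text \<open>Pairs are ordered: \<open>P\<close> is the edge whose private part gets uncolored. The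
  edge \<open>Q\<close> may also contain \<open>v\<close>, a case that matters for color sets
  only.\<close>

definition conflicts :: "'a \<Rightarrow> ('a set \<times> 'a set) set" where
  "conflicts v = (SIGMA P:{P \<in> E. v \<in> P}. {Q \<in> E. Q \<noteq> P \<and> P \<inter> Q \<noteq> {}})"

lemma finite_conflicts: "finite (conflicts v)"
  using finite_E by (simp add: conflicts_def)

lemma conflicts_imp_degree:
  assumes "(P, Q) \<in> conflicts v"
  shows "2 \<le> \<Delta>"
proof -
  obtain u where u: "P \<in> E" "Q \<in> E" "Q \<noteq> P" "u \<in> P" "u \<in> Q"
    using assms by (auto simp: conflicts_def)
  then have "card {P, Q} \<le> card {P \<in> E. u \<in> P}"
    using finite_E by (intro card_mono) auto
  then show ?thesis
    using u card_edges_at_le[of u] edge_subset by force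
qed

text \<open>Conflicts are grouped by \<open>P\<close> and then by \<open>i = card (P - Q)\<close>.
  Dividing the double count \<open>h\<close> by \<open>k - i\<close> bounds each group, and the at
  most \<Delta> choices of \<open>P\<close> supply the remaining factor. The flag
  \<open>v \<in> Q\<close> lets conflicts at a common vertex carry another multiplicity.\<close>

lemma sum_conflicts_le:
  fixes c :: "nat \<Rightarrow> real" and h :: "nat \<Rightarrow> bool \<Rightarrow> nat"
  assumes v: "v \<in> V" and c: "\<And>i. c i \<ge> 0"
    and h: "\<And>P i. P \<in> E \<Longrightarrow> v \<in> P \<Longrightarrow> i \<in> diff_sizes k E \<Longrightarrow>
      (k - i) * (\<Sum>Q | Q \<in> E \<and> Q \<noteq> P \<and> P \<inter> Q \<noteq> {} \<and> card (P - Q) = i. h i (v \<in> Q))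
        \<le> N * ((k - 1) * (\<Delta> - 1))"
  shows "(\<Sum>(P, Q)\<in>conflicts v. c (card (P - Q)) * real (h (card (P - Q)) (v \<in> Q)))
    \<le> (\<Sum>i\<in>diff_sizes k E. c i * (real N * (real \<Delta> * (real \<Delta> - 1) * (real k - 1) / (real k - real i))))"
proof -
  let ?I = "diff_sizes k E"
  let ?B = "\<lambda>i. c i * (real N * ((real \<Delta> - 1) * (real k - 1) / (real k - real i)))"
  have B_nonneg: "?B i \<ge> 0" if "i \<in> ?I" "1 \<le> \<Delta>" for i
    using that c diff_sizes_bounds[OF that(1)] k_ge_2
    by (intro mult_nonneg_nonneg divide_nonneg_nonneg) auto
  have "(\<Sum>(P, Q)\<in>conflicts v. c (card (P - Q)) * real (h (card (P - Q)) (v \<in> Q)))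
      = (\<Sum>P | P \<in> E \<and> v \<in> P. \<Sum>Q | Q \<in> E \<and> Q \<noteq> P \<and> P \<inter> Q \<noteq> {}.
          c (card (P - Q)) * real (h (card (P - Q)) (v \<in> Q)))"
    unfolding conflicts_def using finite_E by (subst sum.Sigma) auto
  also have "\<dots> \<le> (\<Sum>P | P \<in> E \<and> v \<in> P. \<Sum>i\<in>?I. ?B i)"
  proof (rule sum_mono)
    fix P assume "P \<in> {P \<in> E. v \<in> P}"
    then have P: "P \<in> E" "v \<in> P"
      by auto
    \<comment> \<open>Needed to identify the truncated \<open>\<Delta> - 1\<close> of the count with
      the real one.\<close>
    have \<Delta>: "1 \<le> \<Delta>"
    proof -
      have "card {P} \<le> card {P \<in> E. v \<in> P}"
        using P finite_E by (intro card_mono) auto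
      then show ?thesis
        using card_edges_at_le[OF v] by simp
    qed
    have "(\<Sum>Q | Q \<in> E \<and> Q \<noteq> P \<and> P \<inter> Q \<noteq> {}. c (card (P - Q)) * real (h (card (P - Q)) (v \<in> Q)))
        = (\<Sum>i\<in>?I. \<Sum>Q | Q \<in> {Q. Q \<in> E \<and> Q \<noteq> P \<and> P \<inter> Q \<noteq> {}} \<and> card (P - Q) = i.
            c (card (P - Q)) * real (h (card (P - Q)) (v \<in> Q)))"
      using card_Diff_in_diff_sizes P finite_E finite_diff_sizes
      by (intro sum.group[symmetric]) (auto simp: image_subset_iff)
    also have "\<dots> \<le> (\<Sum>i\<in>?I. ?B i)"
    proof (rule sum_mono)
      fix i assume i: "i \<in> ?I"
      let ?S = "\<Sum>Q | Q \<in> E \<and> Q \<noteq> P \<and> P \<inter> Q \<noteq> {} \<and> card (P - Q) = i. h i (v \<in> Q)"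
      have "real ((k - i) * ?S) \<le> real (N * ((k - 1) * (\<Delta> - 1)))"
        using h[OF P i] by (rule of_nat_mono)
      then have "(real k - real i) * real ?S \<le> real N * ((real k - 1) * (real \<Delta> - 1))"
        using \<Delta> k_ge_2 diff_sizes_bounds[OF i] by (simp add: of_nat_diff)
      then have "real ?S \<le> real N * ((real \<Delta> - 1) * (real k - 1) / (real k - real i))"
        using diff_sizes_bounds[OF i] by (simp add: field_simps)
      then have "c i * real ?S \<le> ?B i"
        using c by (intro mult_left_mono)
      moreover have "(\<Sum>Q | Q \<in> {Q. Q \<in> E \<and> Q \<noteq> P \<and> P \<inter> Q \<noteq> {}} \<and> card (P - Q) = i.
          c (card (P - Q)) * real (h (card (P - Q)) (v \<in> Q))) = c i * real ?S"
        unfolding of_nat_sum sum_distrib_left by (rule sum.cong) auto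
      ultimately show "(\<Sum>Q | Q \<in> {Q. Q \<in> E \<and> Q \<noteq> P \<and> P \<inter> Q \<noteq> {}} \<and> card (P - Q) = i.
          c (card (P - Q)) * real (h (card (P - Q)) (v \<in> Q))) \<le> ?B i"
        by simp
    qed
    finally show "(\<Sum>Q | Q \<in> E \<and> Q \<noteq> P \<and> P \<inter> Q \<noteq> {}.
        c (card (P - Q)) * real (h (card (P - Q)) (v \<in> Q))) \<le> (\<Sum>i\<in>?I. ?B i)" .
  qed
  also have "\<dots> = real (card {P \<in> E. v \<in> P}) * (\<Sum>i\<in>?I. ?B i)"
    by simp
  also have "\<dots> \<le> real \<Delta> * (\<Sum>i\<in>?I. ?B i)"
  proof (cases "1 \<le> \<Delta>")
    case True
    then show ?thesis
      using card_edges_at_le[OF v] B_nonneg by (intro mult_right_mono sum_nonneg) auto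
  next
    case False
    then have "\<Delta> = 0" "card {P \<in> E. v \<in> P} = 0"
      using card_edges_at_le[OF v] by auto
    then show ?thesis
      by simp
  qed
  also have "\<dots> = (\<Sum>i\<in>?I. c i * (real N * (real \<Delta> * (real \<Delta> - 1) * (real k - 1) / (real k - real i))))"
    by (simp add: sum_distrib_left mult_ac)
  finally show ?thesis .
qed

section \<open>The multiset version\<close>

text \<open>A new conflict at \<open>v\<close> needs \<open>v\<close> in exactly one of the edges,
  say \<open>P\<close>. Uncoloring \<open>P - Q\<close> keeps the multiset on \<open>Q - P\<close>,
  so at most \<open>i!\<close> colorings of \<open>P - Q\<close> are possible.\<close>

lemma list_iedm_coloring:
  fixes L :: "'a \<Rightarrow> nat set"
  assumes L: "\<And>v. v \<in> V \<Longrightarrow> finite (L v) \<and> card (L v) = R"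
    and R: "1 + (\<Sum>i\<in>diff_sizes k E. q i * root i (real \<Delta> * (real \<Delta> - 1) * (real k - 1) / (real k - real i)
      * fact i)) < real R"
  shows "\<exists>\<phi>\<in>PiE V L. iedm_coloring E \<phi>"
proof -
  let ?I = "diff_sizes k E"
  define w where "w i = real \<Delta> * (real \<Delta> - 1) * (real k - 1) / (real k - real i) * fact i" for i
  define \<beta> where "\<beta> = 1 + (\<Sum>i\<in>?I. root i ((real i - 1) * w i))"
  have w_nonneg: "w i \<ge> 0" if "i \<in> ?I" for i
    using diff_sizes_bounds[OF that] k_ge_2 unfolding w_def
    by (cases "\<Delta> = 0") (auto intro!: mult_nonneg_nonneg divide_nonneg_nonneg)
  have zero: "0 \<notin> ?I"
    using diff_sizes_bounds by force
  have \<beta>_ge_1: "\<beta> \<ge> 1"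
    unfolding \<beta>_def using w_nonneg diff_sizes_bounds
    by (fastforce intro!: sum_nonneg real_root_ge_zero mult_nonneg_nonneg)
  have weight: "\<beta> + (\<Sum>i\<in>?I. w i * (\<beta> / \<beta> ^ i)) \<le> 1 + (\<Sum>i\<in>?I. q i * root i (w i))"
    unfolding \<beta>_def by (rule weight_sum_le[OF finite_diff_sizes zero w_nonneg])
  \<comment> \<open>The colors on \<open>P \<inter> Q\<close> cancel in the comparison of multisets,
    so only the two differences need to be colored.\<close>
  define good where "good D \<phi> \<longleftrightarrow> (\<forall>P\<in>E. \<forall>Q\<in>E. P \<noteq> Q \<longrightarrow> P \<inter> Q \<noteq> {} \<longrightarrow> (P - Q) \<union> (Q - P) \<subseteq> D \<longrightarrow>
    image_mset \<phi> (mset_set (P - Q)) \<noteq> image_mset \<phi> (mset_set (Q - P)))" for D and \<phi> :: "'a \<Rightarrow> nat"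
  define bad where "bad = (\<lambda>D v (P, Q) \<phi>. v \<notin> Q \<and> Q - P \<subseteq> insert v D \<and>
    image_mset \<phi> (mset_set (P - Q)) = image_mset (\<phi> :: 'a \<Rightarrow> nat) (mset_set (Q - P)))"
  define m :: "'a \<Rightarrow> 'a set \<times> 'a set \<Rightarrow> nat"
    where "m v = (\<lambda>(P, Q). if v \<in> Q then 0 else fact (card (P - Q)))" for v
  have "\<exists>\<phi>\<in>PiE V L. good V \<phi>"
  proof (rule coloring_exists[where J = conflicts and U = "\<lambda>v (P, Q). insert v (P - Q)"
        and m = m and bad = bad and \<beta> = \<beta> and R = R, OF finite_V L])
    show "good {} (\<lambda>_. undefined)"
      unfolding good_def by blast
  next
    fix D D' \<phi> assume D: "D' \<subseteq> D" "good D \<phi>"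
    show "good D' (restrict \<phi> D')"
      unfolding good_def
    proof (intro ballI impI)
      fix P Q assume PQ: "P \<in> E" "Q \<in> E" "P \<noteq> Q" "P \<inter> Q \<noteq> {}" "(P - Q) \<union> (Q - P) \<subseteq> D'"
      have "(P - Q) \<union> (Q - P) \<subseteq> D"
        using PQ(5) D(1) by (rule order.trans)
      then have "image_mset \<phi> (mset_set (P - Q)) \<noteq> image_mset \<phi> (mset_set (Q - P))"
        using D(2) PQ(1-4) unfolding good_def by blast
      then show "image_mset (restrict \<phi> D') (mset_set (P - Q)) \<noteq> image_mset (restrict \<phi> D') (mset_set (Q - P))"
        using PQ by (simp add: image_mset_restrict_subset)
    qed
  next
    fix D v \<phi> assume D: "D \<subseteq> V" "v \<in> V - D" "good D (restrict \<phi> D)" "\<not> good (insert v D) \<phi>"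
    obtain P Q where PQ: "P \<in> E" "Q \<in> E" "P \<noteq> Q" "P \<inter> Q \<noteq> {}" "(P - Q) \<union> (Q - P) \<subseteq> insert v D"
      "image_mset \<phi> (mset_set (P - Q)) = image_mset \<phi> (mset_set (Q - P))"
      using D(4) unfolding good_def by blast
    \<comment> \<open>Otherwise both differences were colored already, and the conflict would exist
      on \<open>D\<close>.\<close>
    have "v \<in> (P - Q) \<union> (Q - P)"
    proof (rule ccontr)
      assume "v \<notin> (P - Q) \<union> (Q - P)"
      then have "(P - Q) \<union> (Q - P) \<subseteq> D"
        using PQ by blast
      then show False
        using D(3) PQ unfolding good_def by (auto simp: image_mset_restrict_subset)
    qed
    then consider "v \<in> P" "v \<notin> Q" | "v \<in> Q" "v \<notin> P"
      by blast
    then show "\<exists>j\<in>conflicts v. (case j of (P, Q) \<Rightarrow> insert v (P - Q)) \<subseteq> insert v D \<and> bad D v j \<phi>"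
    proof cases
      case 1
      then show ?thesis
        using PQ by (intro bexI[of _ "(P, Q)"]) (auto simp: bad_def conflicts_def)
    next
      case 2
      then show ?thesis
        using PQ by (intro bexI[of _ "(Q, P)"]) (auto simp: bad_def conflicts_def)
    qed
  next
    fix D v j \<psi>
    assume D: "D \<subseteq> V" "v \<in> V - D" "j \<in> conflicts v"
      and U: "(case j of (P, Q) \<Rightarrow> insert v (P - Q)) \<subseteq> insert v D"
    obtain P Q where j: "j = (P, Q)"
      by fastforce
    then have PQ: "P \<in> E" "Q \<in> E" "v \<in> P" "P - Q \<subseteq> insert v D"
      using D U by (auto simp: conflicts_def)
    let ?D = "insert v D"
    let ?S = "{\<phi> \<in> PiE ?D L. bad D v j \<phi> \<and> restrict \<phi> (?D - (case j of (P, Q) \<Rightarrow> insert v (P - Q))) = \<psi>}"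
    let ?T = "{f \<in> extensional (P - Q). image_mset f (mset_set (P - Q)) = image_mset \<psi> (mset_set (Q - P))}"
    show "card ?S \<le> m v j"
    proof (cases "v \<in> Q")
      case True
      then have "?S = {}"
        by (auto simp: bad_def j)
      then show ?thesis
        by (simp only: card.empty)
    next
      case False
      then have U_eq: "insert v (P - Q) = P - Q"
        using PQ by blast
      have "card ?S \<le> card ?T"
      proof (rule card_le_of_determined_fibre[where D = ?D and U = "P - Q" and \<psi> = \<psi> and g = "\<lambda>\<phi>. restrict \<phi> (P - Q)"])
        show "finite ?T"
          by (intro finite_image_mset_eq finite_Diff finite_edge PQ)
        show "\<phi> \<in> extensional ?D \<and> restrict \<phi> (?D - (P - Q)) = \<psi> \<and> restrict \<phi> (P - Q) \<in> ?T" if "\<phi> \<in> ?S" for \<phi>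
        proof -
          have \<phi>: "\<phi> \<in> extensional ?D" "Q - P \<subseteq> ?D" "restrict \<phi> (?D - (P - Q)) = \<psi>"
            "image_mset \<phi> (mset_set (P - Q)) = image_mset \<phi> (mset_set (Q - P))"
            using that U_eq by (auto simp: bad_def j PiE_def)
          have "image_mset \<psi> (mset_set (Q - P)) = image_mset \<phi> (mset_set (Q - P))"
            unfolding \<phi>(3)[symmetric] using \<phi>(2) by (intro image_mset_restrict_subset) auto
          then show ?thesis
            using \<phi> by (simp add: image_mset_restrict_subset)
        qed
        show "\<phi> x = \<phi>' x" if "restrict \<phi> (P - Q) = restrict \<phi>' (P - Q)" "x \<in> P - Q" for \<phi> \<phi>' :: "'a \<Rightarrow> nat" and x
          using fun_cong[OF that(1), of x] that(2) by simp
      qed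
      also have "\<dots> \<le> fact (card (P - Q))"
        by (intro card_image_mset_eq_le finite_Diff finite_edge PQ)
      finally show ?thesis
        using False by (simp add: m_def j)
    qed
  next
    fix v assume v: "v \<in> V"
    \<comment> \<open>For \<open>v \<notin> Q\<close> the set \<open>P \<inter> Q - {v}\<close> has
      exactly \<open>k - i\<close> elements, which gives the factor \<open>(k - 1) / (k - i)\<close>
      per edge \<open>P\<close>.\<close>
    have count: "(k - i) * (\<Sum>Q | Q \<in> E \<and> Q \<noteq> P \<and> P \<inter> Q \<noteq> {} \<and> card (P - Q) = i. if v \<in> Q then 0 else 1)
        \<le> 1 * ((k - 1) * (\<Delta> - 1))" if P: "P \<in> E" "v \<in> P" for P i
    proof -
      let ?\<Q> = "{Q. Q \<in> E \<and> Q \<noteq> P \<and> P \<inter> Q \<noteq> {} \<and> card (P - Q) = i}"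
      have "(k - i) * (\<Sum>Q\<in>?\<Q>. if v \<in> Q then 0 else 1) \<le> (\<Sum>Q\<in>?\<Q>. card (P \<inter> Q - {v}))"
        unfolding sum_distrib_left
      proof (rule sum_mono)
        fix Q assume "Q \<in> ?\<Q>"
        then show "(k - i) * (if v \<in> Q then 0 else 1) \<le> card (P \<inter> Q - {v})"
          using card_Diff_Int_edge[OF P(1), of Q] by auto
      qed
      also have "\<dots> \<le> (k - 1) * (\<Delta> - 1)"
        using P by (intro sum_card_inter_le) auto
      finally show ?thesis
        by simp
    qed
    have "(\<Sum>j\<in>conflicts v. real (m v j) * (\<beta> / \<beta> ^ card (case j of (P, Q) \<Rightarrow> insert v (P - Q))))
        = (\<Sum>(P, Q)\<in>conflicts v. fact (card (P - Q)) * (\<beta> / \<beta> ^ card (P - Q)) *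
            real (if v \<in> Q then 0 else 1))"
    proof (rule sum.cong)
      fix j assume "j \<in> conflicts v"
      then obtain P Q where "j = (P, Q)" "v \<in> P"
        by (auto simp: conflicts_def)
      moreover from this have "insert v (P - Q) = P - Q" if "v \<notin> Q"
        using that by blast
      ultimately show "real (m v j) * (\<beta> / \<beta> ^ card (case j of (P, Q) \<Rightarrow> insert v (P - Q)))
          = (case j of (P, Q) \<Rightarrow> fact (card (P - Q)) * (\<beta> / \<beta> ^ card (P - Q)) * real (if v \<in> Q then 0 else 1))"
        by (simp add: m_def)
    qed simp
    also have "\<dots> \<le> (\<Sum>i\<in>?I. (fact i * (\<beta> / \<beta> ^ i)) *
        (real 1 * (real \<Delta> * (real \<Delta> - 1) * (real k - 1) / (real k - real i))))"
      using sum_conflicts_le[OF v, where c = "\<lambda>i. fact i * (\<beta> / \<beta> ^ i)" and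
          h = "\<lambda>i b. if b then 0 else 1" and N = 1] count \<beta>_ge_1 by simp
    also have "\<dots> = (\<Sum>i\<in>?I. w i * (\<beta> / \<beta> ^ i))"
      by (simp add: w_def mult_ac)
    finally have "\<beta> + (\<Sum>j\<in>conflicts v. real (m v j) * (\<beta> / \<beta> ^ card (case j of (P, Q) \<Rightarrow> insert v (P - Q))))
        \<le> 1 + (\<Sum>i\<in>?I. q i * root i (w i))"
      using weight by linarith
    then show "\<beta> + (\<Sum>j\<in>conflicts v. real (m v j) * (\<beta> / \<beta> ^ card (case j of (P, Q) \<Rightarrow> insert v (P - Q)))) < real R"
      using R unfolding w_def by linarith
  qed (use \<beta>_ge_1 finite_conflicts in auto)
  then obtain \<phi> where \<phi>: "\<phi> \<in> PiE V L" "good V \<phi>"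
    by blast
  have "iedm_coloring E \<phi>"
    unfolding iedm_coloring_def
  proof (intro ballI impI notI)
    fix P Q assume PQ: "P \<in> E" "Q \<in> E" "P \<noteq> Q \<and> P \<inter> Q \<noteq> {}"
      "image_mset \<phi> (mset_set P) = image_mset \<phi> (mset_set Q)"
    have split: "mset_set A = mset_set (A - B) + mset_set (A \<inter> B)" if "A \<in> E" for A B
      using finite_edge[OF that] by (subst mset_set_Union[symmetric]) (auto simp: Un_Diff_Int)
    have "image_mset \<phi> (mset_set (P - Q)) = image_mset \<phi> (mset_set (Q - P))"
      using PQ(4) split[OF PQ(1), of Q] split[OF PQ(2), of P] by (simp add: Int_commute)
    then show False
      using \<phi>(2) PQ edge_subset unfolding good_def by blast
  qed
  then show ?thesis
    using \<phi> by blast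
qed


section \<open>The set version\<close>

text \<open>Conflicts at a vertex of \<open>P - Q\<close> cost \<open>2 ^ (k - i) * fubini i\<close>
  choices. Conflicts at a common vertex are new; their weights are controlled so that the double
  count at most doubles, which turns the exponent into \<open>k - i + 1\<close>.\<close>

lemma list_ieds_coloring:
  fixes L :: "'a \<Rightarrow> nat set"
  assumes L: "\<And>v. v \<in> V \<Longrightarrow> finite (L v) \<and> card (L v) = R"
    and R: "1 + (\<Sum>i\<in>diff_sizes k E. q i * root i (real \<Delta> * (real \<Delta> - 1) * (real k - 1) / (real k - real i)
      * 2 ^ (k - i + 1) * real (fubini i))) < real R"
  shows "\<exists>\<phi>\<in>PiE V L. ieds_coloring E \<phi>"
proof -
  let ?I = "diff_sizes k E"
  define w where "w i = real \<Delta> * (real \<Delta> - 1) * (real k - 1) / (real k - real i)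
    * 2 ^ (k - i + 1) * real (fubini i)" for i
  define \<beta> where "\<beta> = 1 + (\<Sum>i\<in>?I. root i ((real i - 1) * w i))"
  have w_nonneg: "w i \<ge> 0" if "i \<in> ?I" for i
    using diff_sizes_bounds[OF that] k_ge_2 unfolding w_def
    by (cases "\<Delta> = 0") (auto intro!: mult_nonneg_nonneg divide_nonneg_nonneg)
  have zero: "0 \<notin> ?I"
    using diff_sizes_bounds by force
  have root_nonneg: "root i ((real i - 1) * w i) \<ge> 0" if "i \<in> ?I" for i
    using diff_sizes_bounds[OF that] w_nonneg[OF that]
    by (intro real_root_ge_zero mult_nonneg_nonneg) auto
  have \<beta>_ge_1: "\<beta> \<ge> 1"
    unfolding \<beta>_def using root_nonneg by (auto intro: sum_nonneg)
  \<comment> \<open>A conflict at a common vertex uncolors \<open>i + 1\<close> vertices; the extra factor \<open>1 / \<beta>\<close> pays for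
    the \<open>i\<close> possible colors of that vertex.\<close>
  have \<beta>_large: "real i \<le> 4 * \<beta>" if i: "i \<in> ?I" and \<Delta>: "2 \<le> \<Delta>" for i
  proof (cases "i = 1")
    case True
    then show ?thesis
      using \<beta>_ge_1 by simp
  next
    case False
    then have i2: "2 \<le> i" "i < k"
      using diff_sizes_bounds[OF i] by auto
    \<comment> \<open>All factors of \<open>w i\<close> besides \<open>fubini i\<close> are at least
      1, so \<open>w i \<ge> i!\<close>. The Stirling bound then gives
      \<open>i \<le> 4 * root i ((i - 1) * w i)\<close>, and that root is a summand of
      \<beta>.\<close>
    have "1 \<le> real \<Delta> * (real \<Delta> - 1)"
      using \<Delta> mult_mono[of 1 "real \<Delta>" 1 "real \<Delta> - 1"] by simp
    moreover have "1 \<le> (real k - 1) / (real k - real i)"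
      using i2 by simp
    ultimately have "1 * 1 \<le> real \<Delta> * (real \<Delta> - 1) * ((real k - 1) / (real k - real i))"
      by (intro mult_mono) auto
    then have "1 * 1 \<le> real \<Delta> * (real \<Delta> - 1) * (real k - 1) / (real k - real i) * 2 ^ (k - i + 1)"
      using one_le_power[of "2 :: real" "k - i + 1"] by (intro mult_mono) auto
    moreover have "fact i \<le> real (fubini i)"
      using fact_le_fubini[of i] by (metis of_nat_fact of_nat_le_iff)
    ultimately have "1 * fact i \<le> w i"
      unfolding w_def by (intro mult_mono) auto
    have "real i ^ i \<le> 4 ^ i * fact i"
      by (rule power_le_four_power_fact)
    also have "\<dots> \<le> 4 ^ i * ((real i - 1) * w i)"
      using i2 \<open>1 * fact i \<le> w i\<close> mult_mono[of 1 "real i - 1" "fact i" "w i"] by simp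
    also have "(real i - 1) * w i = root i ((real i - 1) * w i) ^ i"
      using i2 w_nonneg[OF i] by simp
    also have "4 ^ i * root i ((real i - 1) * w i) ^ i \<le> 4 ^ i * \<beta> ^ i"
      using root_nonneg[OF i] member_le_sum[OF i, of "\<lambda>i. root i ((real i - 1) * w i)"]
        root_nonneg finite_diff_sizes
      by (intro mult_left_mono power_mono) (auto simp: \<beta>_def)
    also have "\<dots> = (4 * \<beta>) ^ i"
      by (simp add: power_mult_distrib)
    finally show ?thesis
      using i2 \<beta>_ge_1 power_mono_iff[of "real i" "4 * \<beta>" i] by simp
  qed
  have weight: "\<beta> + (\<Sum>i\<in>?I. w i * (\<beta> / \<beta> ^ i)) \<le> 1 + (\<Sum>i\<in>?I. q i * root i (w i))"
    unfolding \<beta>_def by (rule weight_sum_le[OF finite_diff_sizes zero w_nonneg])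
  \<comment> \<open>A pair counts as a conflict as soon as its symmetric difference is colored. Coloring a common
    vertex can then create a conflict only if its color is the unique one separating the two
    color sets; demanding \<open>P \<union> Q \<subseteq> D\<close> instead would leave that color unconstrained.\<close>
  define good where "good D \<phi> \<longleftrightarrow> (\<forall>P\<in>E. \<forall>Q\<in>E. P \<noteq> Q \<longrightarrow> P \<inter> Q \<noteq> {} \<longrightarrow> (P - Q) \<union> (Q - P) \<subseteq> D \<longrightarrow>
    \<phi> ` (P \<inter> D) \<noteq> \<phi> ` (Q \<inter> D))" for D and \<phi> :: "'a \<Rightarrow> nat"
  \<comment> \<open>For a common vertex \<open>v\<close>, the edge \<open>Q\<close> is the one that
    already shows the color of \<open>v\<close> on \<open>D\<close>, and \<open>P\<close> the one
    that gets it only through \<open>v\<close>.\<close>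
  define bad where "bad = (\<lambda>D v (P, Q) (\<phi> :: 'a \<Rightarrow> nat).
    if v \<in> Q then (P - Q) \<union> (Q - P) \<subseteq> D \<and> \<phi> v \<in> \<phi> ` (Q - P) \<and> \<phi> ` (P \<inter> D) = \<phi> ` (Q \<inter> D) - {\<phi> v}
    else (P - Q) \<union> (Q - P) \<subseteq> insert v D \<and> \<phi> ` (P \<inter> insert v D) = \<phi> ` (Q \<inter> insert v D))"
  \<comment> \<open>If \<open>v \<in> Q\<close>, its color is one of the at most \<open>i\<close>
    colors on \<open>Q - P\<close>, and only \<open>k - i - 1\<close> common vertices remain to
    contribute known colors.\<close>
  define m :: "'a \<Rightarrow> 'a set \<times> 'a set \<Rightarrow> nat"
    where "m v = (\<lambda>(P, Q). let i = card (P - Q) in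
      if v \<in> Q then i * (2 ^ (k - i - 1) * fubini i) else 2 ^ (k - i) * fubini i)" for v
  define U where "U = (\<lambda>v (P, Q). insert v (P - Q :: 'a set))"
  have "\<exists>\<phi>\<in>PiE V L. good V \<phi>"
  proof (rule coloring_exists[where J = conflicts and U = U and m = m and bad = bad and \<beta> = \<beta> and R = R,
        OF finite_V L])
    show "good {} (\<lambda>_. undefined)"
      unfolding good_def by blast
  next
    fix D D' \<phi> assume D: "D' \<subseteq> D" "good D \<phi>"
    show "good D' (restrict \<phi> D')"
      unfolding good_def
    proof (intro ballI impI)
      fix P Q assume PQ: "P \<in> E" "Q \<in> E" "P \<noteq> Q" "P \<inter> Q \<noteq> {}" "(P - Q) \<union> (Q - P) \<subseteq> D'"
      have "(P - Q) \<union> (Q - P) \<subseteq> D"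
        using PQ(5) D(1) by (rule order.trans)
      then have ne: "\<phi> ` (P \<inter> D) \<noteq> \<phi> ` (Q \<inter> D)"
        using D(2) PQ(1-4) unfolding good_def by blast
      \<comment> \<open>Passing from \<open>D'\<close> to \<open>D\<close> adds the same colors to
        both edges, so equality on \<open>D'\<close> would persist on \<open>D\<close>.\<close>
      have "P \<inter> D = (P \<inter> D') \<union> (P \<inter> Q \<inter> D)" "Q \<inter> D = (Q \<inter> D') \<union> (P \<inter> Q \<inter> D)"
        using PQ(5) D(1) by blast+
      then have "\<phi> ` (P \<inter> D') \<noteq> \<phi> ` (Q \<inter> D')"
        using ne by (metis image_Un)
      then show "restrict \<phi> D' ` (P \<inter> D') \<noteq> restrict \<phi> D' ` (Q \<inter> D')"
        by simp
    qed
  next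
    fix D v \<phi> assume D: "D \<subseteq> V" "v \<in> V - D" "good D (restrict \<phi> D)" "\<not> good (insert v D) \<phi>"
    obtain P Q where PQ: "P \<in> E" "Q \<in> E" "P \<noteq> Q" "P \<inter> Q \<noteq> {}" "(P - Q) \<union> (Q - P) \<subseteq> insert v D"
      and eq: "\<phi> ` (P \<inter> insert v D) = \<phi> ` (Q \<inter> insert v D)"
      using D(4) unfolding good_def by blast
    have ne: "\<phi> ` (P \<inter> D) \<noteq> \<phi> ` (Q \<inter> D)" if "(P - Q) \<union> (Q - P) \<subseteq> D"
    proof -
      have "restrict \<phi> D ` (P \<inter> D) \<noteq> restrict \<phi> D ` (Q \<inter> D)"
        using D(3) PQ that unfolding good_def by blast
      then show ?thesis
        by simp
    qed
    consider "v \<notin> P" "v \<notin> Q" | "v \<in> P" "v \<notin> Q" | "v \<in> Q" "v \<notin> P" | "v \<in> P" "v \<in> Q"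
      by blast
    then show "\<exists>j\<in>conflicts v. U v j \<subseteq> insert v D \<and> bad D v j \<phi>"
    proof cases
      case 1
      then have "P \<inter> insert v D = P \<inter> D" "Q \<inter> insert v D = Q \<inter> D" "(P - Q) \<union> (Q - P) \<subseteq> D"
        using PQ(5) by auto
      then show ?thesis
        using ne eq by simp
    next
      case 2
      then show ?thesis
        using PQ eq by (intro bexI[of _ "(P, Q)"]) (auto simp: bad_def conflicts_def U_def)
    next
      case 3
      then show ?thesis
        using PQ eq by (intro bexI[of _ "(Q, P)"]) (auto simp: bad_def conflicts_def U_def)
    next
      case 4
      then have sub: "(P - Q) \<union> (Q - P) \<subseteq> D"
        using PQ(5) by auto
      have ins: "insert (\<phi> v) (\<phi> ` (P \<inter> D)) = insert (\<phi> v) (\<phi> ` (Q \<inter> D))"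
        using eq 4 by (simp add: Int_insert_right)
      \<comment> \<open>The two color sets differ on \<open>D\<close> but agree once
        \<open>\<phi> v\<close> is added, so exactly one contains \<open>\<phi> v\<close>. That edge
        becomes \<open>Q'\<close>, and the color must sit on \<open>Q' - P'\<close> because
        \<open>P'\<close> lacks it.\<close>
      have key: "bad D v (P', Q') \<phi>"
        if "v \<in> Q'" "(P' - Q') \<union> (Q' - P') \<subseteq> D" "\<phi> v \<in> \<phi> ` (Q' \<inter> D)" "\<phi> v \<notin> \<phi> ` (P' \<inter> D)"
          "insert (\<phi> v) (\<phi> ` (P' \<inter> D)) = insert (\<phi> v) (\<phi> ` (Q' \<inter> D))" for P' Q'
      proof -
        have "\<phi> v \<in> \<phi> ` (Q' - P')"
          using that(3,4) by blast
        then show ?thesis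
          using that by (simp add: bad_def) (metis Diff_insert_absorb insert_absorb)
      qed
      have "\<phi> v \<in> \<phi> ` (Q \<inter> D) \<and> \<phi> v \<notin> \<phi> ` (P \<inter> D) \<or> \<phi> v \<in> \<phi> ` (P \<inter> D) \<and> \<phi> v \<notin> \<phi> ` (Q \<inter> D)"
        using ins ne[OF sub] by (metis insert_absorb insert_ident)
      then have "bad D v (P, Q) \<phi> \<or> bad D v (Q, P) \<phi>"
        using key[of Q P] key[of P Q] 4 sub ins by auto
      moreover have "(P, Q) \<in> conflicts v" "(Q, P) \<in> conflicts v" "U v (P, Q) \<subseteq> insert v D" "U v (Q, P) \<subseteq> insert v D"
        using PQ 4 by (auto simp: conflicts_def U_def)
      ultimately show ?thesis
        by blast
    qed
  next
    fix D v j \<psi>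
    assume D: "D \<subseteq> V" "v \<in> V - D" "j \<in> conflicts v" and U: "U v j \<subseteq> insert v D"
    obtain P Q where j: "j = (P, Q)"
      by fastforce
    then have PQ: "P \<in> E" "Q \<in> E" "v \<in> P" "P - Q \<subseteq> insert v D"
      using D U by (auto simp: conflicts_def U_def)
    have fin: "finite P" "finite (P - Q)" "finite (P \<inter> Q)"
      using PQ finite_edge by auto
    let ?D = "insert v D" and ?A = "P - Q" and ?i = "card (P - Q)"
    let ?S = "{\<phi> \<in> PiE ?D L. bad D v j \<phi> \<and> restrict \<phi> (?D - U v j) = \<psi>}"
    have \<psi>: "\<psi> x = \<phi> x" if "\<phi> \<in> ?S" "x \<in> ?D - U v j" for \<phi> x
      using that by auto
    show "card ?S \<le> m v j"
    proof (cases "v \<in> Q")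
      case False
      then have U_eq: "U v j = ?A"
        using PQ by (auto simp: U_def j)
      \<comment> \<open>Only \<open>P - Q\<close> is uncolored, so \<psi> still determines the whole
        color set of \<open>Q\<close> and the colors on the common part.\<close>
      let ?Y = "\<psi> ` (P \<inter> Q \<inter> ?D)"
      let ?T = "{f \<in> extensional ?A. f ` ?A \<union> ?Y = \<psi> ` (Q \<inter> ?D)}"
      have "card ?S \<le> card ?T"
      proof (rule card_le_of_determined_fibre[where D = ?D and U = "U v j" and \<psi> = \<psi> and g = "\<lambda>\<phi>. restrict \<phi> ?A"])
        show "finite ?T"
          using fin by (intro finite_image_Un_eq) auto
        show "\<phi> \<in> extensional ?D \<and> restrict \<phi> (?D - U v j) = \<psi> \<and> restrict \<phi> ?A \<in> ?T" if \<phi>: "\<phi> \<in> ?S" for \<phi>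
        proof -
          have eq: "\<phi> ` (P \<inter> ?D) = \<phi> ` (Q \<inter> ?D)"
            using \<phi> False by (auto simp: bad_def j)
          have "?Y = \<phi> ` (P \<inter> Q \<inter> ?D)" "\<psi> ` (Q \<inter> ?D) = \<phi> ` (Q \<inter> ?D)"
            using \<psi>[OF \<phi>] by (auto intro!: image_cong simp: U_eq)
          moreover have "P \<inter> ?D = ?A \<union> (P \<inter> Q \<inter> ?D)"
            using PQ by blast
          ultimately have "\<phi> ` ?A \<union> ?Y = \<psi> ` (Q \<inter> ?D)"
            using eq by (metis image_Un)
          then show ?thesis
            using \<phi> by (simp add: PiE_def)
        qed
        show "\<phi> x = \<phi>' x" if "restrict \<phi> ?A = restrict \<phi>' ?A" "x \<in> U v j" for \<phi> \<phi>' :: "'a \<Rightarrow> nat" and x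
          using fun_cong[OF that(1), of x] that(2) by (simp add: U_eq)
      qed
      also have "\<dots> \<le> 2 ^ card ?Y * fubini ?i"
        using fin by (intro card_image_Un_eq_le) auto
      also have "\<dots> \<le> 2 ^ (k - ?i) * fubini ?i"
      proof -
        have "card ?Y \<le> card (P \<inter> Q \<inter> ?D)"
          using fin by (intro card_image_le) auto
        also have "\<dots> \<le> card (P \<inter> Q)"
          using fin by (intro card_mono) auto
        also have "\<dots> = k - ?i"
          using card_Diff_Int_edge[OF PQ(1), of Q] by simp
        finally show ?thesis
          by (intro mult_right_mono power_increasing) auto
      qed
      finally show ?thesis
        using False by (simp add: m_def j Let_def)
    next
      case True
      then have U_eq: "U v j = insert v ?A"
        by (auto simp: U_def j)
      let ?Y = "\<psi> ` (P \<inter> Q \<inter> D)"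
      let ?F = "\<lambda>c. {f \<in> extensional ?A. f ` ?A \<union> ?Y = \<psi> ` (Q \<inter> D) - {c}}"
      \<comment> \<open>First the color \<open>c\<close> of \<open>v\<close> is chosen among the
        colors on \<open>Q - P\<close>, then the colors on \<open>P - Q\<close>. Since
        \<open>v \<notin> D\<close>, all the sets read off from \<psi> survive the
        uncoloring.\<close>
      let ?T = "SIGMA c:\<psi> ` (Q - P). ?F c"
      have fin': "finite (Q - P)"
        using PQ finite_edge by auto
      have fin_F: "finite (?F c)" for c
        using fin by (intro finite_image_Un_eq) auto
      have "card ?S \<le> card ?T"
      proof (rule card_le_of_determined_fibre[where D = ?D and U = "U v j" and \<psi> = \<psi> and g = "\<lambda>\<phi>. (\<phi> v, restrict \<phi> ?A)"])
        show "finite ?T"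
          using fin' fin_F by (intro finite_SigmaI) auto
        show "\<phi> \<in> extensional ?D \<and> restrict \<phi> (?D - U v j) = \<psi> \<and> (\<phi> v, restrict \<phi> ?A) \<in> ?T" if \<phi>: "\<phi> \<in> ?S" for \<phi>
        proof -
          have bad: "(P - Q) \<union> (Q - P) \<subseteq> D" "\<phi> v \<in> \<phi> ` (Q - P)" "\<phi> ` (P \<inter> D) = \<phi> ` (Q \<inter> D) - {\<phi> v}"
            using \<phi> True by (auto simp: bad_def j)
          have \<psi>_eq: "\<psi> x = \<phi> x" if "x \<in> Q" "x \<in> D" for x
            using \<psi>[OF \<phi>, of x] that D(2) by (auto simp: U_eq)
          then have "?Y = \<phi> ` (P \<inter> Q \<inter> D)" "\<psi> ` (Q \<inter> D) = \<phi> ` (Q \<inter> D)"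
            by (auto intro!: image_cong)
          moreover have "\<psi> ` (Q - P) = \<phi> ` (Q - P)"
            using bad(1) \<psi>_eq by (intro image_cong) auto
          moreover have "P \<inter> D = ?A \<union> (P \<inter> Q \<inter> D)"
            using bad(1) by blast
          ultimately have "\<phi> ` ?A \<union> ?Y = \<psi> ` (Q \<inter> D) - {\<phi> v}" "\<phi> v \<in> \<psi> ` (Q - P)"
            using bad by (metis image_Un, metis)
          then show ?thesis
            using \<phi> by (simp add: PiE_def)
        qed
        show "\<phi> x = \<phi>' x" if "(\<phi> v, restrict \<phi> ?A) = (\<phi>' v, restrict \<phi>' ?A)" "x \<in> U v j" for \<phi> \<phi>' :: "'a \<Rightarrow> nat" and x
        proof (cases "x = v")
          case False
          then have "x \<in> ?A"
            using that(2) by (simp add: U_eq)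
          moreover have "restrict \<phi> ?A x = restrict \<phi>' ?A x"
            using that(1) by simp
          ultimately show ?thesis
            by simp
        qed (use that(1) in simp)
      qed
      also have "\<dots> = (\<Sum>c\<in>\<psi> ` (Q - P). card (?F c))"
        using fin' fin_F by (intro card_SigmaI) auto
      also have "\<dots> \<le> (\<Sum>c\<in>\<psi> ` (Q - P). 2 ^ (k - ?i - 1) * fubini ?i)"
      proof (rule sum_mono)
        fix c
        have "card (?F c) \<le> 2 ^ card ?Y * fubini ?i"
          using fin by (intro card_image_Un_eq_le) auto
        also have "\<dots> \<le> 2 ^ (k - ?i - 1) * fubini ?i"
        proof -
          have "card ?Y \<le> card (P \<inter> Q \<inter> D)"
            using fin by (intro card_image_le) auto
          also have "\<dots> \<le> card (P \<inter> Q - {v})"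
            using fin D by (intro card_mono) auto
          also have "\<dots> = k - ?i - 1"
            using card_Diff_Int_edge[OF PQ(1), of Q] PQ True by (simp add: card_Diff_singleton)
          finally show ?thesis
            by (intro mult_right_mono power_increasing) auto
        qed
        finally show "card (?F c) \<le> 2 ^ (k - ?i - 1) * fubini ?i" .
      qed
      also have "\<dots> = card (\<psi> ` (Q - P)) * (2 ^ (k - ?i - 1) * fubini ?i)"
        by simp
      also have "\<dots> \<le> ?i * (2 ^ (k - ?i - 1) * fubini ?i)"
      proof (rule mult_right_mono)
        have "card (\<psi> ` (Q - P)) \<le> card (Q - P)"
          using fin' by (rule card_image_le)
        also have "\<dots> = ?i"
          using card_Diff_Int_edge[OF PQ(1), of Q] card_Diff_Int_edge[OF PQ(2), of P]
          by (simp add: Int_commute)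
        finally show "card (\<psi> ` (Q - P)) \<le> ?i" .
      qed simp
      finally show ?thesis
        using True by (simp add: m_def j Let_def)
    qed
  next
    fix v assume v: "v \<in> V"
    \<comment> \<open>A conflict at a common vertex has weight at most
      \<open>?c i * (i / (2 * \<beta>))\<close>, and \<open>i / (2 * \<beta>) \<le> min 2 i\<close>
      by \<open>i \<le> 4 * \<beta>\<close> and \<open>\<beta> \<ge> 1\<close>. The plain value 2
      would break the count below for \<open>i = 1\<close>.\<close>
    let ?h = "\<lambda>i b. if b then min 2 i else 1"
    let ?c = "\<lambda>i. 2 ^ (k - i) * real (fubini i) * (\<beta> / \<beta> ^ i)"
    have count: "(k - i) * (\<Sum>Q | Q \<in> E \<and> Q \<noteq> P \<and> P \<inter> Q \<noteq> {} \<and> card (P - Q) = i. ?h i (v \<in> Q))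
        \<le> 2 * ((k - 1) * (\<Delta> - 1))" if P: "P \<in> E" "v \<in> P" and i: "i \<in> ?I" for P i
    proof -
      let ?\<Q> = "{Q. Q \<in> E \<and> Q \<noteq> P \<and> P \<inter> Q \<noteq> {} \<and> card (P - Q) = i}"
      \<comment> \<open>At most \<open>\<Delta> - 1\<close> of the edges \<open>Q\<close> contain
        \<open>v\<close>; the surplus \<open>k - 1\<close> granted to each adds one more
        \<open>(k - 1) * (\<Delta> - 1)\<close>.\<close>
      have "(k - i) * (\<Sum>Q\<in>?\<Q>. ?h i (v \<in> Q))
          \<le> (\<Sum>Q\<in>?\<Q>. card (P \<inter> Q - {v}) + (if v \<in> Q then k - 1 else 0))"
        unfolding sum_distrib_left
      proof (rule sum_mono)
        fix Q assume Q: "Q \<in> ?\<Q>"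
        show "(k - i) * ?h i (v \<in> Q) \<le> card (P \<inter> Q - {v}) + (if v \<in> Q then k - 1 else 0)"
        proof (cases "v \<in> Q")
          case True
          then have "card (P \<inter> Q - {v}) = k - i - 1"
            using card_Diff_Int_edge[OF P(1), of Q] P Q by (simp add: card_Diff_singleton)
          moreover have "(k - i) * min 2 i \<le> k - i - 1 + (k - 1)"
            using diff_sizes_bounds[OF i] by (cases "i = 1") auto
          ultimately show ?thesis
            using True by simp
        next
          case False
          then show ?thesis
            using card_Diff_Int_edge[OF P(1), of Q] Q by auto
        qed
      qed
      also have "\<dots> = (\<Sum>Q\<in>?\<Q>. card (P \<inter> Q - {v})) + (k - 1) * card {Q \<in> ?\<Q>. v \<in> Q}"
        using finite_E by (simp add: sum.distrib sum.If_cases Collect_conj_eq Int_ac)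
      also have "\<dots> \<le> (k - 1) * (\<Delta> - 1) + (k - 1) * (\<Delta> - 1)"
        using P by (intro add_mono mult_left_mono sum_card_inter_le card_other_edges_at_le) auto
      finally show ?thesis
        by simp
    qed
    have "(\<Sum>j\<in>conflicts v. real (m v j) * (\<beta> / \<beta> ^ card (U v j)))
        \<le> (\<Sum>(P, Q)\<in>conflicts v. ?c (card (P - Q)) * real (?h (card (P - Q)) (v \<in> Q)))"
    proof (rule sum_mono)
      fix j assume "j \<in> conflicts v"
      then obtain P Q where j: "j = (P, Q)" "(P, Q) \<in> conflicts v"
        by (cases j) auto
      then have PQ: "P \<in> E" "Q \<in> E" "P \<noteq> Q" "P \<inter> Q \<noteq> {}" "v \<in> P"
        by (auto simp: conflicts_def)
      define i where "i = card (P - Q)"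
      have i: "i \<in> ?I"
        using PQ card_Diff_in_diff_sizes by (simp add: i_def)
      have "real (m v j) * (\<beta> / \<beta> ^ card (U v j)) \<le> ?c i * real (?h i (v \<in> Q))"
      proof (cases "v \<in> Q")
        case False
        then have "insert v (P - Q) = P - Q"
          using PQ by blast
        then show ?thesis
          using False by (simp add: j m_def U_def i_def Let_def)
      next
        case True
        then have card_U: "card (U v j) = Suc i"
          using PQ finite_edge by (simp add: j U_def i_def)
        have "2 * 2 ^ (k - i - 1) = (2 :: real) ^ (k - i)"
        proof -
          have "k - i = Suc (k - i - 1)"
            using diff_sizes_bounds[OF i] by linarith
          then show ?thesis
            by (metis power_Suc)
        qed
        then have "real (m v j) * (\<beta> / \<beta> ^ card (U v j)) = ?c i * (real i / (2 * \<beta>))"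
          using True \<beta>_ge_1 unfolding card_U by (simp add: j m_def i_def Let_def field_simps)
        also have "\<dots> \<le> ?c i * real (min 2 i)"
        proof (rule mult_left_mono)
          have "real i \<le> 4 * \<beta>"
            using \<beta>_large[OF i] conflicts_imp_degree[OF j(2)] by simp
          moreover have "real i \<le> 2 * \<beta> * real i"
            using \<beta>_ge_1 mult_right_mono[of 1 "2 * \<beta>" "real i"] by simp
          ultimately show "real i / (2 * \<beta>) \<le> real (min 2 i)"
            using \<beta>_ge_1 by (simp add: field_simps min_def)
        qed (use \<beta>_ge_1 in auto)
        finally show ?thesis
          using True by simp
      qed
      then show "real (m v j) * (\<beta> / \<beta> ^ card (U v j))
          \<le> (case j of (P, Q) \<Rightarrow> ?c (card (P - Q)) * real (?h (card (P - Q)) (v \<in> Q)))"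
        unfolding i_def j(1) prod.case .
    qed
    also have "\<dots> \<le> (\<Sum>i\<in>?I. ?c i * (real 2 * (real \<Delta> * (real \<Delta> - 1) * (real k - 1) / (real k - real i))))"
      using \<beta>_ge_1 count by (intro sum_conflicts_le[OF v]) auto
    also have "\<dots> = (\<Sum>i\<in>?I. w i * (\<beta> / \<beta> ^ i))"
      by (simp add: w_def mult_ac)
    finally have "\<beta> + (\<Sum>j\<in>conflicts v. real (m v j) * (\<beta> / \<beta> ^ card (U v j)))
        \<le> 1 + (\<Sum>i\<in>?I. q i * root i (w i))"
      using weight by linarith
    then show "\<beta> + (\<Sum>j\<in>conflicts v. real (m v j) * (\<beta> / \<beta> ^ card (U v j))) < real R"
      using R unfolding w_def by linarith
  qed (use \<beta>_ge_1 finite_conflicts in \<open>auto simp: U_def\<close>)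
  then obtain \<phi> where \<phi>: "\<phi> \<in> PiE V L" "good V \<phi>"
    by blast
  have "ieds_coloring E \<phi>"
    unfolding ieds_coloring_def
  proof (intro ballI impI)
    fix P Q assume PQ: "P \<in> E" "Q \<in> E" "P \<noteq> Q \<and> P \<inter> Q \<noteq> {}"
    then have "P \<inter> V = P" "Q \<inter> V = Q"
      using edge_subset by auto
    moreover from this PQ have "\<phi> ` (P \<inter> V) \<noteq> \<phi> ` (Q \<inter> V)"
      using \<phi>(2) unfolding good_def by blast
    ultimately show "\<phi> ` P \<noteq> \<phi> ` Q"
      by simp
  qed
  then show ?thesis
    using \<phi> by blast
qed

end

section \<open>From arbitrary lists to the theorem\<close>

text \<open>Counting colorings needs finite lists of a common size, and a coloring from sublists is
  one from the original lists.\<close>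

lemma exists_finite_sublists:
  assumes "\<forall>v\<in>V. at_least R (L v)"
  shows "\<exists>L'. \<forall>v\<in>V. L' v \<subseteq> L v \<and> finite (L' v) \<and> card (L' v) = R"
proof -
  have "\<exists>A\<subseteq>L v. finite A \<and> card A = R" if "v \<in> V" for v
  proof (cases "finite (L v)")
    case True
    then show ?thesis
      using assms that obtain_subset_with_card_n[of R "L v"] by (auto simp: at_least_def)
  next
    case False
    then show ?thesis
      using infinite_arbitrarily_large[of "L v" R] by auto
  qed
  then show ?thesis
    by metis
qed

theorem theorem3p1:
  fixes k \<Delta> R :: nat
    and V :: "'a set"
    and E :: "'a set set"
    and I :: "nat set"
    and L :: "'a \<Rightarrow> nat set"
  assumes "2 \<le> k"
    and "finite V"
    and "hypergraph V E"
    and "uniform k E"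
    and "max_degree V E \<le> \<Delta>"
    and "diff_sizes k E = I"
    and "\<forall>v\<in>V. at_least R (L v)"
  shows "(int R \<ge> \<lceil>2 + (\<Sum>i\<in>I. q i *
            root i (real \<Delta> * (real \<Delta> - 1) * (real k - 1) / (real k - real i)
                    * 2 ^ (k - i + 1) * real (fubini i)))\<rceil>
          \<longrightarrow> (\<exists>\<phi>. list_coloring V L \<phi> \<and> ieds_coloring E \<phi>))
       \<and> (int R \<ge> \<lceil>2 + (\<Sum>i\<in>I. q i *
            root i (real \<Delta> * (real \<Delta> - 1) * (real k - 1) / (real k - real i)
                    * fact i))\<rceil>
          \<longrightarrow> (\<exists>\<phi>. list_coloring V L \<phi> \<and> iedm_coloring E \<phi>))"
proof -
  interpret bounded_degree_hypergraph V E k \<Delta>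
    using assms by unfold_locales
  obtain L' where L': "\<forall>v\<in>V. L' v \<subseteq> L v \<and> finite (L' v) \<and> card (L' v) = R"
    using exists_finite_sublists[OF assms(7)] by blast
  have *: "list_coloring V L \<phi>" if "\<phi> \<in> PiE V L'" for \<phi>
    using that L' by (fastforce simp: list_coloring_def PiE_def Pi_def)
  have lift: "\<exists>\<phi>. list_coloring V L \<phi> \<and> C \<phi>" if "\<exists>\<phi>\<in>PiE V L'. C \<phi>" for C
    using that * by blast
  show ?thesis
    \<comment> \<open>The summand 2 in the bound leaves room for the strict inequality with summand
      1 that the counting argument uses.\<close>
    unfolding assms(6)[symmetric] ceiling_le_iff
  proof (intro conjI impI lift)
    assume "2 + (\<Sum>i\<in>diff_sizes k E. q i *
      root i (real \<Delta> * (real \<Delta> - 1) * (real k - 1) / (real k - real i)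
        * 2 ^ (k - i + 1) * real (fubini i))) \<le> real_of_int (int R)"
    then show "\<exists>\<phi>\<in>PiE V L'. ieds_coloring E \<phi>"
      using L' by (intro list_ieds_coloring[of L' R]) auto
  next
    assume "2 + (\<Sum>i\<in>diff_sizes k E. q i *
      root i (real \<Delta> * (real \<Delta> - 1) * (real k - 1) / (real k - real i) * fact i)) \<le> real_of_int (int R)"
    then show "\<exists>\<phi>\<in>PiE V L'. iedm_coloring E \<phi>"
      using L' by (intro list_iedm_coloring[of L' R]) auto
  qed
qed

end
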